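(* Let $p$ be a prime with $p \neq 2$ and $p \neq 5$. Then the sequence $(\nu_p(F_{n+1}))_{n \geq 0}$ is a $p$-regular sequence of rank $\alpha(p) + 1$.
   Context: $F_n$ denotes the $n$th Fibonacci number: $F_1 = F_2 = 1$ and $F_{n+2} = F_{n+1} + F_n$ for $n \geq 1$. For an integer $m \geq 1$, $\alpha(m)$ is the smallest integer $n \geq 1$ such that $F_n \equiv 0 \pmod m$ (such an $n$ always exists). For a prime $p$ and an integer $n \geq 1$, $\nu_p(n)$ is the exponent of the highest power of $p$ dividing $n$ (the $p$-adic valuation). For an integer $k \geq 2$, the $k$-kernel of a sequence $s(n)_{n \geq 0}$ is the set of sequences $\ker_k s(n)_{n\ge 0} = \{ s(k^e n + i)_{n \geq 0} : e \geq 0,\ 0 \leq i \leq k^e - 1 \}$. The sequence $s(n)_{n \geq 0}$ is $k$-regular if the $\mathbb{Z}$-module $\langle \ker_k s(n)_{n\ge 0} \rangle$ generated by its $k$-kernel (under termwise operations) is finitely generated. The rank of a $k$-regular sequence is the rank of this $\mathbb{Z}$-module (the maximal number of $\mathbb{Z}$-linearly independent elements). *)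

theory Defs
  imports
    "HOL-Number_Theory.Fib"
    "HOL-Computational_Algebra.Primes"
    "HOL-Library.Function_Algebras"
    "HOL-Library.Extended_Nat"
begin

definition rank_of_apparition :: "nat \<Rightarrow> nat" where
  "rank_of_apparition m = (LEAST n. 1 \<le> n \<and> m dvd fib n)"

definition k_kernel :: "nat \<Rightarrow> (nat \<Rightarrow> int) \<Rightarrow> (nat \<Rightarrow> int) set" where
  "k_kernel k s = {(\<lambda>n. s (k ^ e * n + i)) |e i. i < k ^ e}"

(* The integer sequences as a Z-module: addition is the pointwise one of
   Function_Algebras, and int_seq.span and int_seq.independent are the notions
   of the module locale for integer coefficients. *)
definition seq_scale :: "int \<Rightarrow> (nat \<Rightarrow> int) \<Rightarrow> (nat \<Rightarrow> int)" where
  "seq_scale c s = (\<lambda>n. c * s n)"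

global_interpretation int_seq: module seq_scale
  by standard (simp_all add: seq_scale_def fun_eq_iff algebra_simps)

definition finitely_generated :: "(nat \<Rightarrow> int) set \<Rightarrow> bool" where
  "finitely_generated M \<longleftrightarrow> (\<exists>B. finite B \<and> int_seq.span B = M)"

(* Valued in enat, so that the supremum is meaningful also when M contains
   independent sets of unbounded size. *)
definition module_rank :: "(nat \<Rightarrow> int) set \<Rightarrow> enat" where
  "module_rank M = (SUP B \<in> {B. B \<subseteq> M \<and> finite B \<and> int_seq.independent B}. enat (card B))"

definition k_regular :: "nat \<Rightarrow> (nat \<Rightarrow> int) \<Rightarrow> bool" where
  "k_regular k s \<longleftrightarrow> finitely_generated (int_seq.span (k_kernel k s))"

definition k_regular_rank :: "nat \<Rightarrow> (nat \<Rightarrow> int) \<Rightarrow> enat" where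
  "k_regular_rank k s = module_rank (int_seq.span (k_kernel k s))"

end

(* Put a = alpha(p) and c = v_p(F_a). Since p does not divide a, v_p(F_n) is c + v_p(n) if a
   divides n, and 0 otherwise. For 1 <= j < p^e the kernel sequence v_p(F_(p^e n + j)) is therefore
   c + v_p(j) times the indicator of a residue class modulo a, and for j = p^e it is
   v_p(F_(n+1)) plus e times such an indicator. By the Chinese remainder theorem every class
   is attained by some j with v_p(j) = 0 and by some j with v_p(j) = 1; the difference of the two
   kernel sequences is the bare indicator. Hence the module is freely generated by the a indicators
   and the sequence itself, which is independent of them because it is unbounded. *)

theory Submission
  imports Defs "HOL-Number_Theory.Cong"
begin

section \<open>Fibonacci numbers at multiples of an index, and modulo a prime\<close>

text \<open>The shift operator E on the Fibonacci sequence satisfies E^(c+1) = F_(c+1) E + F_c; this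
  is the binomial expansion of its nth power, applied at index \<open>m\<close>.\<close>

lemma fib_mult_Suc_add:
  "fib (n * Suc c + m) = (\<Sum>k\<le>n. (n choose k) * fib (Suc c) ^ k * fib c ^ (n - k) * fib (k + m))"
proof (induction n arbitrary: m)
  case 0
  then show ?case by simp
next
  case (Suc n)
  let ?x = "fib (Suc c)" and ?y = "fib c"
  let ?f = "\<lambda>n k. (n choose k) * ?x ^ k * ?y ^ (n - k)"
  have step: "fib (k + (Suc c + m)) = ?x * fib (Suc k + m) + ?y * fib (k + m)" for k
    using fib_add[of "k + m" c] by (simp add: ac_simps)
  have "fib (Suc n * Suc c + m) = fib (n * Suc c + (Suc c + m))"
    by (simp add: ac_simps)
  also have "\<dots> = (\<Sum>k\<le>n. ?f n k * (?x * fib (Suc k + m) + ?y * fib (k + m)))"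
    using Suc.IH[of "Suc c + m"] by (simp only: step)
  also have "\<dots> = (\<Sum>k\<le>n. (n choose k) * ?x ^ Suc k * ?y ^ (n - k) * fib (Suc k + m)) +
      (\<Sum>k\<le>n. (n choose k) * ?x ^ k * ?y ^ (Suc n - k) * fib (k + m))"
    unfolding sum.distrib[symmetric] by (intro sum.cong) (auto simp: algebra_simps Suc_diff_le)
  \<comment> \<open>The added term has \<open>n choose Suc n\<close> = 0. Splitting off k = 0 next
    aligns the powers of \<open>?x\<close> in both sums, so that Pascal's rule merges them.\<close>
  also have "(\<Sum>k\<le>n. (n choose k) * ?x ^ k * ?y ^ (Suc n - k) * fib (k + m)) =
      (\<Sum>k\<le>Suc n. (n choose k) * ?x ^ k * ?y ^ (Suc n - k) * fib (k + m))"
    by simp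
  also have "\<dots> = ?y ^ Suc n * fib m +
      (\<Sum>k\<le>n. (n choose Suc k) * ?x ^ Suc k * ?y ^ (n - k) * fib (Suc k + m))"
    by (subst sum.atMost_Suc_shift) simp
  finally show ?case
    by (subst sum.atMost_Suc_shift) (simp add: sum.distrib algebra_simps)
qed

text \<open>The inner binomial coefficients vanish modulo \<open>p\<close>; only the terms k = 0 and
  k = p of the expansion survive.\<close>

lemma fib_prime_mult_add_cong:
  assumes "prime p"
  shows "[fib (p * Suc c + m) = fib c ^ p * fib m + fib (Suc c) ^ p * fib (p + m)] (mod p)"
proof -
  let ?t = "\<lambda>k. (p choose k) * fib (Suc c) ^ k * fib c ^ (p - k) * fib (k + m)"
  have p: "p > 0" using assms by (simp add: prime_gt_0_nat)
  have "{..p} = insert 0 (insert p {0<..<p})"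
    using p by auto
  then have "fib (p * Suc c + m) = ?t 0 + (?t p + sum ?t {0<..<p})"
    unfolding fib_mult_Suc_add using p by simp
  moreover have "p dvd sum ?t {0<..<p}"
  proof (rule dvd_sum)
    fix k assume "k \<in> {0<..<p}"
    then have "p dvd (p choose k)"
      using assms by (intro dvd_choose_prime) auto
    then show "p dvd ?t k" by (simp only: mult.assoc dvd_mult2)
  qed
  then have "[?t 0 + (?t p + sum ?t {0<..<p}) = ?t 0 + (?t p + 0)] (mod p)"
    by (intro cong_add cong_refl) (simp only: cong_0_iff)
  moreover have "?t 0 + (?t p + 0) = fib c ^ p * fib m + fib (Suc c) ^ p * fib (p + m)"
    by simp
  ultimately show ?thesis by (simp only:)
qed

lemma prime_not_dvd_fib_self:
  assumes "prime p" "p \<noteq> 2" "p \<noteq> 5"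
  shows "\<not> p dvd fib p"
proof
  (* With u = F_(p+1) and F_p = 0 mod p, Cassini gives u^2 = -1, and F_(2p+1) computed in two ways
     gives u^2 = 1 + u. Hence u = -2 and 5 = 0 mod p. *)
  assume dvd: "p dvd fib p"
  have "odd p" "p > 2"
    using assms prime_odd_nat prime_ge_2_nat[of p] by (auto simp: le_less)
  define q where "q = p - 1"
  have p: "p = Suc q" and "even q" "q > 1"
    using \<open>odd p\<close> \<open>p > 2\<close> by (auto simp: q_def)
  define u where "u = int (fib (Suc p))"
  define v where "v = int (fib p)"
  have "[int (fib (p * Suc 1 + 1)) = int (1 + fib (p + 1))] (mod int p)"
    using fib_prime_mult_add_cong[OF assms(1), of 1 1] by (subst cong_int_iff) simp
  moreover have "fib (p * Suc 1 + 1) = fib (Suc p)^2 + fib p^2"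
    using fib_add[of p p] by (simp add: power2_eq_square mult_2_right)
  ultimately have 1: "[u^2 + v^2 = 1 + u] (mod int p)"
    by (simp add: u_def v_def)
  \<comment> \<open>Here \<open>u - v\<close> is F_(p-1), and the sign in Cassini's identity is
    fixed by \<open>q\<close> = p - 1 being even.\<close>
  have 2: "u * (u - v) - v^2 = -1"
    using fib_Cassini_int[of q] \<open>even q\<close> by (simp add: u_def v_def p)
  have v: "int p dvd v"
    using dvd by (simp add: v_def)
  have "u\<^sup>2 + 1 = v * (u + v)"
    using 2 by (simp add: algebra_simps power2_eq_square)
  then have 3: "int p dvd u\<^sup>2 + 1"
    using v by simp
  have "u + 2 = (u\<^sup>2 + 1) - ((u\<^sup>2 + v\<^sup>2) - (1 + u)) + v * v"
    by (simp add: power2_eq_square)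
  then have "int p dvd u + 2"
    using v 1 3 by (metis cong_iff_dvd_diff dvd_add dvd_diff dvd_mult)
  moreover have "5 = (u\<^sup>2 + 1) - (u + 2) * (u - 2)"
    by (simp add: power2_eq_square algebra_simps)
  ultimately have "int p dvd 5"
    using 3 by (metis dvd_diff dvd_mult2)
  then have "p dvd 5"
    by presburger
  then show False
    using assms primes_dvd_imp_eq[of p 5] by simp
qed

section \<open>Existence and divisibility property of the rank of apparition\<close>

text \<open>The recurrence also runs backwards, so a repeated pair of consecutive residues can be
  shifted down to indices 0 and j - i, where F_0 = 0.\<close>

lemma dvd_fib_diff:
  assumes "i \<le> j" "[fib i = fib j] (mod m)" "[fib (Suc i) = fib (Suc j)] (mod m)"
  shows "m dvd fib (j - i)"
  using assms
proof (induction i arbitrary: j)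
  case 0
  then show ?case by (auto simp: cong_0_iff dest: cong_sym)
next
  case (Suc i)
  then obtain k where k: "j = Suc k" by (cases j) auto
  have "[fib (Suc i) + fib i = fib (Suc i) + fib k] (mod m)"
    using Suc.prems(3) cong_add[OF cong_sym[OF Suc.prems(2)] cong_refl[of "fib k"]] k
    by (simp add: cong_def)
  then have "[fib i = fib k] (mod m)"
    by (simp only: cong_add_lcancel_nat)
  then show ?case
    using Suc.IH[of k] Suc.prems k by simp
qed

text \<open>Pigeonhole: there are only finitely many pairs of consecutive residues, so one of them
  repeats.\<close>

lemma exists_dvd_fib:
  assumes "m > 0"
  shows "\<exists>n\<ge>1. m dvd fib n"
proof -
  let ?h = "\<lambda>n. (fib n mod m, fib (Suc n) mod m)"
  have "range ?h \<subseteq> {..<m} \<times> {..<m}"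
    using assms by auto
  then have "\<not> inj ?h"
    using finite_subset finite_imageD infinite_UNIV_nat by blast
  then obtain i j where "i < j" "?h i = ?h j"
    unfolding inj_def by (metis linorder_neqE_nat)
  then have "j - i \<ge> 1" "m dvd fib (j - i)"
    using dvd_fib_diff[of i j m] by (auto simp: cong_def)
  then show ?thesis by blast
qed

lemma
  assumes "m > 0"
  shows rank_of_apparition_pos: "rank_of_apparition m > 0"
    and dvd_fib_rank_of_apparition: "m dvd fib (rank_of_apparition m)"
  using LeastI_ex[of "\<lambda>n. 1 \<le> n \<and> m dvd fib n"] exists_dvd_fib[OF assms]
  unfolding rank_of_apparition_def by auto

text \<open>Both directions use gcd(F_a, F_n) = F_gcd(a,n); if \<open>m\<close> divides it,
  minimality of a forces gcd(a,n) = a.\<close>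

lemma dvd_fib_iff_rank_of_apparition_dvd:
  assumes "m > 0"
  shows "m dvd fib n \<longleftrightarrow> rank_of_apparition m dvd n"
proof
  let ?a = "rank_of_apparition m"
  assume "m dvd fib n"
  then have "m dvd fib (gcd ?a n)"
    using dvd_fib_rank_of_apparition[OF assms] by (simp add: fib_gcd)
  then have "?a \<le> gcd ?a n"
    unfolding rank_of_apparition_def[of m]
    by (intro Least_le) (use rank_of_apparition_pos[OF assms] in \<open>auto simp: rank_of_apparition_def Suc_le_eq\<close>)
  then have "gcd ?a n = ?a"
    using rank_of_apparition_pos[OF assms] by (simp add: gcd_le1_nat le_antisym)
  then show "?a dvd n"
    by (metis gcd_dvd2)
next
  let ?a = "rank_of_apparition m"
  assume "?a dvd n"
  then have "gcd (fib ?a) (fib n) = fib ?a"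
    by (simp add: fib_gcd[symmetric] gcd_nat.absorb1)
  then show "m dvd fib n"
    using dvd_fib_rank_of_apparition[OF assms] by (metis gcd_dvd2 dvd_trans)
qed

section \<open>Rank of a finitely generated module of integer sequences\<close>

lemma int_seq_independent_imp_card_le:
  assumes "int_seq.independent S" "finite S" "finite B" "S \<subseteq> int_seq.span B"
  shows "card S \<le> card B"
proof -
  (* Clearing denominators keeps integer independent sequences independent over the rationals, where
     the exchange lemma is available. *)
  define scale :: "rat \<Rightarrow> (nat \<Rightarrow> rat) \<Rightarrow> nat \<Rightarrow> rat" where "scale = (\<lambda>c s n. c * s n)"
  interpret rat_seq: vector_space scale
    by standard (simp_all add: scale_def fun_eq_iff algebra_simps)
  define emb :: "(nat \<Rightarrow> int) \<Rightarrow> nat \<Rightarrow> rat" where "emb = (\<lambda>s n. of_int (s n))"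
  have inj: "inj emb"
    by (auto simp: emb_def inj_def fun_eq_iff)
  have emb_lin: "emb 0 = 0" "emb (s + t) = emb s + emb t"
    "emb (seq_scale c s) = scale (of_int c) (emb s)" for s t c
    by (auto simp: emb_def scale_def seq_scale_def fun_eq_iff)
  have emb_sum: "emb (sum f A) = (\<Sum>x\<in>A. emb (f x))" for f :: "(nat \<Rightarrow> int) \<Rightarrow> nat \<Rightarrow> int" and A
    by (induction A rule: infinite_finite_induct)
      (simp_all only: sum.infinite sum.empty sum.insert emb_lin not_False_eq_True)
  have "emb s \<in> rat_seq.span (emb ` B)" if "s \<in> int_seq.span B" for s
    using that
  proof (induction rule: int_seq.span_induct_alt)
    case base
    then show ?case by (simp only: emb_lin rat_seq.span_zero)
  next
    case (step c x y)
    then show ?case unfolding emb_lin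
      by (intro rat_seq.span_add[OF rat_seq.span_scale[OF rat_seq.span_base]] imageI)
  qed
  then have span: "emb ` S \<subseteq> rat_seq.span (emb ` B)"
    using assms(4) by auto
  have "rat_seq.independent (emb ` S)"
    unfolding rat_seq.dependent_finite[OF finite_imageI[OF assms(2)]]
  proof safe
    fix u s
    assume s: "s \<in> S" "u (emb s) \<noteq> 0" and "(\<Sum>v\<in>emb ` S. scale (u v) v) = 0"
    then have sum0: "(\<Sum>v\<in>S. scale (u (emb v)) (emb v)) = 0"
      by (simp only: sum.reindex[OF inj_on_subset[OF inj subset_UNIV]] o_def)
    define den where "den v = snd (quotient_of (u (emb v)))" for v
    define D where "D = (\<Prod>v\<in>S. den v)"
    have den_pos: "den v > 0" for v
      unfolding den_def by (rule quotient_of_denom_pos')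
    have "\<exists>z. of_int D * u (emb v) = of_int z" if "v \<in> S" for v
    proof -
      have "den v dvd D"
        unfolding D_def using assms(2) that by (rule dvd_prodI)
      then obtain k where "D = den v * k" ..
      moreover have "u (emb v) = of_int (fst (quotient_of (u (emb v)))) / of_int (den v)"
        unfolding den_def by (rule quotient_of_div) simp
      ultimately have "of_int D * u (emb v) = of_int (k * fst (quotient_of (u (emb v))))"
        using den_pos[of v] by (simp add: field_simps)
      then show ?thesis by blast
    qed
    then obtain z where z: "\<And>v. v \<in> S \<Longrightarrow> of_int D * u (emb v) = of_int (z v)"
      by metis
    \<comment> \<open>Multiplied by the common denominator \<open>D\<close>, the rational relation
      is the image of an integer one, which injectivity of \<open>emb\<close> pulls back.\<close>
    have "emb (\<Sum>v\<in>S. seq_scale (z v) v) = (\<Sum>v\<in>S. scale (of_int D) (scale (u (emb v)) (emb v)))"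
      unfolding emb_sum by (intro sum.cong) (simp_all add: emb_lin z)
    also have "\<dots> = emb 0"
      unfolding rat_seq.scale_sum_right[symmetric] sum0 by (simp only: emb_lin rat_seq.scale_zero_right)
    finally have "(\<Sum>v\<in>S. seq_scale (z v) v) = 0"
      using inj by (simp only: inj_eq)
    then have "z s = 0"
      by (rule int_seq.independentD[OF assms(1,2) subset_refl _ s(1)])
    moreover have "D > 0"
      unfolding D_def by (intro prod_pos) (simp add: den_pos)
    ultimately show False
      using z[OF s(1)] s(2) by simp
  qed
  then have "card (emb ` S) \<le> card (emb ` B)"
    using rat_seq.independent_span_bound[OF finite_imageI[OF assms(3)] _ span] by blast
  then show ?thesis
    using inj by (simp add: card_image inj_on_subset[OF inj])
qed

text \<open>The supremum is attained at \<open>B\<close> itself, by the preceding bound on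
  independent subsets of its span.\<close>

lemma module_rank_span:
  assumes "finite B" "int_seq.independent B"
  shows "module_rank (int_seq.span B) = enat (card B)"
  unfolding module_rank_def
proof (rule antisym)
  show "(SUP S\<in>{S. S \<subseteq> int_seq.span B \<and> finite S \<and> int_seq.independent S}. enat (card S)) \<le> enat (card B)"
    using assms(1) by (intro SUP_least) (auto intro: int_seq_independent_imp_card_le)
next
  show "enat (card B) \<le> (SUP S\<in>{S. S \<subseteq> int_seq.span B \<and> finite S \<and> int_seq.independent S}. enat (card S))"
    using assms by (intro SUP_upper) (auto intro: int_seq.span_base)
qed

section \<open>The p-adic valuation of Fibonacci numbers\<close>

text \<open>In the expansion of F_(mn) the term k = 0 vanishes because F_0 = 0, the term k = 1 is
  isolated, and all later terms contain F_n^2. For the second claim, \<open>m\<close> divides the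
  inner binomial coefficients, while the term k = m keeps a factor F_n^(m-2) with m > 2.\<close>

lemma fib_mult_factor:
  assumes "n > 0" "m > 0"
  obtains t where "fib (m * n) = fib n * (m * fib (n - 1) ^ (m - 1) + fib n * t)"
    and "prime m \<Longrightarrow> m dvd fib n \<Longrightarrow> m > 2 \<Longrightarrow> m * m dvd fib n * t"
proof -
  obtain c where n: "n = Suc c" using assms(1) by (cases n) auto
  let ?x = "fib n" and ?y = "fib c"
  let ?t = "\<lambda>k. (m choose k) * ?x ^ (k - 2) * ?y ^ (m - k) * fib k"
  have "{..m} = insert 0 (insert 1 {2..m})"
    using assms(2) by auto
  then have "fib (m * n) = m * ?x * ?y ^ (m - 1) + (\<Sum>k=2..m. (m choose k) * ?x ^ k * ?y ^ (m - k) * fib k)"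
    using fib_mult_Suc_add[of m c 0] n by simp
  also have "(\<Sum>k=2..m. (m choose k) * ?x ^ k * ?y ^ (m - k) * fib k) = ?x * (?x * sum ?t {2..m})"
    unfolding sum_distrib_left
  proof (intro sum.cong refl)
    fix k assume "k \<in> {2..m}"
    then obtain l where "k = Suc (Suc l)"
      by (auto simp: numeral_2_eq_2 Suc_le_eq elim!: less_natE)
    then show "(m choose k) * ?x ^ k * ?y ^ (m - k) * fib k = ?x * (?x * ?t k)"
      by (simp del: fib.simps binomial_Suc_Suc)
  qed
  finally have "fib (m * n) = fib n * (m * fib (n - 1) ^ (m - 1) + fib n * sum ?t {2..m})"
    by (simp add: n distrib_left mult_ac)
  moreover have "m * m dvd fib n * sum ?t {2..m}"
    if m: "prime m" "m dvd fib n" "m > 2"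
  proof (intro mult_dvd_mono m dvd_sum)
    fix k assume k: "k \<in> {2..m}"
    show "m dvd ?t k"
    proof (cases "k = m")
      case True
      then show ?thesis using m by (auto intro!: dvd_mult2 dvd_trans[OF m(2)] dvd_power)
    next
      case False
      then show ?thesis using m k by (auto intro!: dvd_mult2 dvd_choose_prime)
    qed
  qed
  ultimately show thesis by (rule that)
qed

text \<open>Induction that strips one factor \<open>p\<close> from \<open>m\<close> at a time: a
  factor prime to \<open>p\<close> leaves the valuation unchanged, and each factor \<open>p\<close>
  raises it by exactly one.\<close>

lemma multiplicity_fib_mult:
  assumes "prime p" "p \<noteq> 2" "p dvd fib n" "n > 0" "m > 0"
  shows "multiplicity p (fib (m * n)) = multiplicity p (fib n) + multiplicity p m"
  using assms(5)
proof (induction m rule: less_induct)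
  case (less m)
  have elem: "prime_elem p" and p0: "p > 0" using assms(1) by (auto simp: prime_gt_0_nat)
  have p2: "p > 2" using assms(1,2) prime_ge_2_nat[of p] by auto
  \<comment> \<open>Consecutive Fibonacci numbers are coprime, so the leading term in the bracket of
    \<open>fib_mult_factor\<close> has no factor \<open>p\<close> beyond those of the
    multiplier.\<close>
  have ndvd: "\<not> p dvd fib (l - 1) ^ k" if "p dvd fib l" "l > 0" for l k
  proof
    assume "p dvd fib (l - 1) ^ k"
    then have "p dvd fib (l - 1)" using assms(1) prime_dvd_power by blast
    moreover have "coprime (fib (l - 1)) (fib l)"
      using coprime_fib_Suc_nat[of "l - 1"] that by simp
    ultimately show False
      using that(1) assms(1) coprime_common_divisor_nat not_prime_1 by blast
  qed
  have mult_unit: "multiplicity p (y * z) = multiplicity p y" if "y \<noteq> 0" "\<not> p dvd z" for y z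
  proof -
    have "z \<noteq> 0" using that(2) by (rule contrapos_nn) simp
    then show ?thesis
      using prime_elem_multiplicity_mult_distrib[OF elem that(1)] that(2)
      by (simp add: not_dvd_imp_multiplicity_0)
  qed
  show ?case
  proof (cases "p dvd m")
    case False
    from fib_mult_factor[OF assms(4) less.prems] obtain t where
      t: "fib (m * n) = fib n * (m * fib (n - 1) ^ (m - 1) + fib n * t)" by blast
    have "\<not> p dvd m * fib (n - 1) ^ (m - 1)"
      using False ndvd[OF assms(3,4)] assms(1) by (simp add: prime_dvd_mult_iff)
    then have "\<not> p dvd m * fib (n - 1) ^ (m - 1) + fib n * t"
      using assms(3) by (simp add: dvd_add_left_iff)
    then have "multiplicity p (fib (m * n)) = multiplicity p (fib n)"
      unfolding t using fib_neq_0_nat[OF assms(4)] by (intro mult_unit) auto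
    then show ?thesis using False by (simp add: not_dvd_imp_multiplicity_0)
  next
    case True
    then obtain l where l: "m = p * l" by (elim dvdE)
    then have l0: "l > 0" "l < m" using less.prems p2 by auto
    let ?x = "fib (l * n)" and ?y = "fib (l * n - 1)"
    have ln: "l * n > 0" using l0 assms(4) by simp
    have "fib n dvd ?x" 
      by (metis dvd_triv_right fib_gcd gcd_nat.absorb_iff1)
    then have px: "p dvd ?x" using assms(3) dvd_trans by blast
    from fib_mult_factor[OF ln p0] obtain t where
      t: "fib (p * (l * n)) = ?x * (p * ?y ^ (p - 1) + ?x * t)" and "p * p dvd ?x * t"
      using assms(1) px p2 by blast
    then obtain u where u: "?x * t = p * p * u" by (elim dvdE)
    \<comment> \<open>Since the higher terms contain p^2, the bracket is \<open>p\<close> times this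
      unit modulo \<open>p\<close>.\<close>
    have "\<not> p dvd ?y ^ (p - 1) + p * u"
      using ndvd[OF px ln] by (simp add: dvd_add_left_iff)
    then have "multiplicity p (?x * (?y ^ (p - 1) + p * u)) = multiplicity p ?x"
      using fib_neq_0_nat[OF ln] by (intro mult_unit) auto
    moreover have "fib (m * n) = p * (?x * (?y ^ (p - 1) + p * u))"
      using t unfolding u l by (simp only: distrib_left mult_ac)
    moreover have "fib (m * n) \<noteq> 0"
      using fib_neq_0_nat[of "m * n"] assms(4) less.prems by simp
    ultimately have "multiplicity p (fib (m * n)) = Suc (multiplicity p ?x)"
      using elem by (metis mult_eq_0_iff multiplicity_times_same not_prime_elem_zero prime_elem_not_unit)
    moreover have "multiplicity p m = Suc (multiplicity p l)"
      unfolding l using l0 elem by (subst multiplicity_times_same) auto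
    ultimately show ?thesis
      using less.IH[OF l0(2,1)] by simp
  qed
qed

lemma rank_of_apparition_gt_1:
  assumes "m > 1"
  shows "rank_of_apparition m > 1"
  using rank_of_apparition_pos[of m] dvd_fib_rank_of_apparition[of m] assms
  by (cases "rank_of_apparition m = 1") auto

text \<open>If a = pb, then F_a = F_b^p F_p modulo \<open>p\<close>. As \<open>p\<close> does not
  divide F_p, it divides F_b with b < a, against minimality.\<close>

lemma coprime_rank_of_apparition:
  assumes "prime p" "p \<noteq> 2" "p \<noteq> 5"
  shows "coprime p (rank_of_apparition p)"
proof (rule ccontr)
  let ?a = "rank_of_apparition p"
  have p: "p > 1" using assms(1) by (rule prime_gt_1_nat)
  assume "\<not> coprime p ?a"
  then have "p dvd ?a" using assms(1) prime_imp_coprime by blast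
  then obtain b where b: "?a = p * b" by (elim dvdE)
  then have "b > 0" using rank_of_apparition_pos[of p] p by (cases b) auto
  then obtain c where c: "b = Suc c" by (cases b) auto
  have "[fib (p * Suc c) = fib (Suc c) ^ p * fib p] (mod p)"
    using fib_prime_mult_add_cong[OF assms(1), of c 0] by simp
  then have "p dvd fib b ^ p * fib p"
    using dvd_fib_rank_of_apparition[of p] p b c by (simp add: cong_dvd_iff)
  then have "p dvd fib b"
    using prime_not_dvd_fib_self[OF assms] assms(1) prime_dvd_mult_iff prime_dvd_power by blast
  then have "?a dvd b"
    using dvd_fib_iff_rank_of_apparition_dvd[of p b] p by simp
  then have "p * b \<le> 1 * b"
    using \<open>b > 0\<close> b by (simp add: dvd_imp_le)
  then show False using \<open>b > 0\<close> p by simp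
qed

text \<open>Write n = ma; since \<open>p\<close> does not divide a, the numbers m and n have the
  same valuation.\<close>

lemma multiplicity_fib:
  assumes "prime p" "p \<noteq> 2" "p \<noteq> 5" "n > 0"
  defines "a \<equiv> rank_of_apparition p"
  shows "multiplicity p (fib n) = (if a dvd n then multiplicity p (fib a) + multiplicity p n else 0)"
proof (cases "a dvd n")
  case True
  have p: "p > 0" using assms(1) by (simp add: prime_gt_0_nat)
  have a: "a > 0" "p dvd fib a"
    using p unfolding a_def by (auto intro: rank_of_apparition_pos dvd_fib_rank_of_apparition)
  obtain m where m: "n = m * a" using True by (metis dvd_def mult.commute)
  then have "m > 0" using assms(4) by (cases m) auto
  have "\<not> p dvd a"
    using coprime_rank_of_apparition[OF assms(1-3)] assms(1)
    unfolding a_def by (metis coprime_absorb_left not_prime_unit)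
  then have "multiplicity p n = multiplicity p m"
    unfolding m using assms(1) a \<open>m > 0\<close>
    by (subst prime_elem_multiplicity_mult_distrib) (auto simp: not_dvd_imp_multiplicity_0)
  then show ?thesis
    using multiplicity_fib_mult[OF assms(1,2) a(2,1) \<open>m > 0\<close>] True m by simp
next
  case False
  then have "\<not> p dvd fib n"
    using assms(1) dvd_fib_iff_rank_of_apparition_dvd[of p n] by (simp add: prime_gt_0_nat a_def)
  then show ?thesis using False by (simp add: not_dvd_imp_multiplicity_0)
qed

text \<open>The valuation of \<open>j\<close> is below \<open>e\<close>, and that of p^e n is at
  least \<open>e\<close>, so the smaller one decides. The case n = 0 is separate because
  \<open>multiplicity p 0\<close> is 0 by convention.\<close>

lemma multiplicity_power_mult_add:
  fixes p :: nat
  assumes "prime p" "0 < j" "j < p ^ e"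
  shows "multiplicity p (p ^ e * n + j) = multiplicity p j"
proof (cases "n = 0")
  case False
  have "multiplicity p j < e"
    using assms nat_dvd_not_less[OF assms(2,3)] prime_gt_1_nat[OF assms(1)]
    by (intro multiplicity_lessI) auto
  also have "e \<le> multiplicity p (p ^ e * n)"
    using assms(1) False by (intro multiplicity_geI) (auto simp: prime_gt_0_nat)
  finally show ?thesis
    using multiplicity_sum_lt[of p j "p ^ e * n"] assms False by (simp add: add.commute prime_gt_0_nat)
qed simp

section \<open>Indicators of residue classes\<close>

text \<open>The class is that of -r. With this sign, r = 1 marks the indices n with a dividing n +
  1, matching the shifted sequence F_(n+1).\<close>

definition residue_indicator :: "nat \<Rightarrow> nat \<Rightarrow> nat \<Rightarrow> int" where
  "residue_indicator a r = (\<lambda>n. of_bool (a dvd n + r))"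

text \<open>Points that separate the indicators. The free multiple \<open>m\<close> allows
  arbitrarily large points in each class; the subtraction is not truncated since q < a \<le> m
  a.\<close>

lemma residue_indicator_at:
  assumes "q < a" "r < a" "m > 0"
  shows "residue_indicator a r (m * a - q) = of_bool (q = r)"
proof -
  have "1 * a \<le> m * a"
    using assms(3) by (intro mult_le_mono1) simp
  then have sum: "m * a - q + q = m * a"
    using assms(1) by linarith
  have "a dvd m * a - q + r \<longleftrightarrow> [m * a - q + r = m * a - q + q] (mod a)"
    unfolding sum by (simp add: cong_def dvd_eq_mod_eq_0)
  also have "\<dots> \<longleftrightarrow> [r = q] (mod a)"
    by (rule cong_add_lcancel_nat)
  also have "\<dots> \<longleftrightarrow> q = r"
    using assms(1,2) by (auto simp: cong_def)
  finally show ?thesis by (simp add: residue_indicator_def)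
qed

lemma inj_residue_indicator: "inj_on (residue_indicator a) {..<a}"
proof (rule inj_onI)
  fix q r assume "q \<in> {..<a}" "r \<in> {..<a}" "residue_indicator a q = residue_indicator a r"
  then show "q = r"
    using residue_indicator_at[of q a r 1] residue_indicator_at[of q a q 1]
    by (simp split: if_splits)
qed

lemma sum_fun_apply: "(\<Sum>x\<in>A. f x) y = (\<Sum>x\<in>A. f x y)"
  by (induction A rule: infinite_finite_induct) auto

section \<open>The kernel of the valuation sequence and its basis\<close>

context
  fixes p a c :: nat and s :: "nat \<Rightarrow> int"
  assumes p: "prime p" "p \<noteq> 2" "p \<noteq> 5"
  defines "a \<equiv> rank_of_apparition p"
    and "c \<equiv> multiplicity p (fib a)"
    and "s \<equiv> \<lambda>n. int (multiplicity p (fib (n + 1)))"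
begin

lemma coprime_power_rank: "coprime (p ^ e) a"
  using coprime_rank_of_apparition[OF p] by (simp add: a_def)

lemma rank_gt_1: "a > 1"
  unfolding a_def by (rule rank_of_apparition_gt_1[OF prime_gt_1_nat[OF p(1)]])

text \<open>The shift by one turns the index p^e n + p^e - 1 into p^e (n+1), and p^e is invertible
  modulo \<open>a\<close>.\<close>

lemma kernel_last_residue:
  "(\<lambda>n. s (p ^ e * n + (p ^ e - 1))) = s + seq_scale (int e) (residue_indicator a 1)"
proof
  fix n
  have pos: "p ^ e > 0" using p(1) by (simp add: prime_gt_0_nat)
  have "p ^ e * n + (p ^ e - 1) + 1 = p ^ e * (n + 1)"
    using pos by (simp add: algebra_simps)
  then have "s (p ^ e * n + (p ^ e - 1)) = int (multiplicity p (fib (p ^ e * (n + 1))))"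
    by (simp only: s_def)
  moreover have "a dvd p ^ e * (n + 1) \<longleftrightarrow> a dvd n + 1"
    using coprime_power_rank[of e] by (metis coprime_commute coprime_dvd_mult_right_iff)
  moreover have "multiplicity p (p ^ e * (n + 1)) = e + multiplicity p (n + 1)"
    using p(1) by (subst prime_elem_multiplicity_mult_distrib) (auto simp: prime_gt_0_nat)
  ultimately have "s (p ^ e * n + (p ^ e - 1)) =
      int (if a dvd n + 1 then c + (e + multiplicity p (n + 1)) else 0)"
    using pos multiplicity_fib[OF p, of "p ^ e * (n + 1)"] unfolding a_def c_def by force
  moreover have "s n = int (if a dvd n + 1 then c + multiplicity p (n + 1) else 0)"
    using multiplicity_fib[OF p, of "n + 1"] unfolding s_def a_def c_def by simp
  ultimately show "s (p ^ e * n + (p ^ e - 1)) =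
      (s + seq_scale (int e) (residue_indicator a 1)) n"
    by (simp add: seq_scale_def residue_indicator_def)
qed

text \<open>Here \<open>r\<close> is \<open>j\<close> divided by p^e modulo \<open>a\<close>, so
  \<open>a\<close> divides p^e n + j exactly when it divides n + r; the valuation of p^e n + j does
  not depend on n.\<close>

lemma kernel_other_residue:
  assumes "0 < j" "j < p ^ e" "[p ^ e * r = j] (mod a)"
  shows "(\<lambda>n. s (p ^ e * n + (j - 1))) =
    seq_scale (int (c + multiplicity p j)) (residue_indicator a r)"
proof
  fix n
  have "[p ^ e * (n + r) = p ^ e * n + j] (mod a)"
    using cong_add[OF cong_refl assms(3), of "p ^ e * n"] by (simp add: algebra_simps)
  then have "a dvd p ^ e * n + j \<longleftrightarrow> a dvd n + r"
    using coprime_power_rank[of e] cong_dvd_iff[of "p ^ e * (n + r)" "p ^ e * n + j" a]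
    by (simp add: coprime_dvd_mult_right_iff coprime_commute)
  moreover have "p ^ e * n + (j - 1) + 1 = p ^ e * n + j"
    using assms(1) by simp
  ultimately show "s (p ^ e * n + (j - 1)) =
      seq_scale (int (c + multiplicity p j)) (residue_indicator a r) n"
    using assms(1) multiplicity_power_mult_add[OF p(1) assms(1,2), of n]
      multiplicity_fib[OF p, of "p ^ e * n + j"]
    unfolding s_def c_def seq_scale_def residue_indicator_def a_def by simp
qed

definition "kernel_basis = insert s (residue_indicator a ` {..<a})"

lemma k_kernel_subset: "k_kernel p s \<subseteq> int_seq.span kernel_basis"
proof
  fix t assume "t \<in> k_kernel p s"
  then obtain e i where t: "t = (\<lambda>n. s (p ^ e * n + i))" and i: "i < p ^ e"
    by (auto simp: k_kernel_def)
  show "t \<in> int_seq.span kernel_basis"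
  proof (cases "i = p ^ e - 1")
    case True
    show ?thesis
      unfolding t True kernel_last_residue using rank_gt_1
      by (intro int_seq.span_add int_seq.span_scale int_seq.span_base) (auto simp: kernel_basis_def)
  next
    case False
    \<comment> \<open>\<open>x\<close> inverts p^e modulo \<open>a\<close>; reducing x (i+1) modulo
      \<open>a\<close> gives the index of a basis indicator.\<close>
    obtain x where x: "[p ^ e * x = 1] (mod a)"
      using cong_solve_coprime_nat[OF coprime_power_rank[of e]] by auto
    define r where "r = (x * (i + 1)) mod a"
    have "[p ^ e * r = p ^ e * x * (i + 1)] (mod a)"
      unfolding r_def by (simp only: cong_def mod_mult_right_eq mult.assoc)
    also have "[p ^ e * x * (i + 1) = 1 * (i + 1)] (mod a)"
      using x by (rule cong_mult) simp
    finally have r: "[p ^ e * r = i + 1] (mod a)" by simp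
    have "r < a" using rank_gt_1 by (simp add: r_def)
    moreover have "t = seq_scale (int (c + multiplicity p (i + 1))) (residue_indicator a r)"
      using kernel_other_residue[of "i + 1" e r] r i False t by simp
    ultimately show ?thesis
      by (simp add: int_seq.span_scale int_seq.span_base kernel_basis_def del: of_nat_add)
  qed
qed

lemma kernel_basis_subset: "kernel_basis \<subseteq> int_seq.span (k_kernel p s)"
proof -
  have "s \<in> k_kernel p s"
    unfolding k_kernel_def by (auto intro!: exI[of _ 0])
  moreover have "residue_indicator a r \<in> int_seq.span (k_kernel p s)" for r
  proof -
    \<comment> \<open>Any exponent with a p^2 < p^e serves: it leaves room below p^e for every
      solution of the congruences below.\<close>
    define e where "e = a * p ^ 2"
    have e: "a * p ^ 2 < p ^ e"
      unfolding e_def using prime_ge_2_nat[OF p(1)] by (intro power_gt_expt) auto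
    have mem: "seq_scale (int (c + k)) (residue_indicator a r) \<in> int_seq.span (k_kernel p s)"
      if k: "k < 2" for k
    proof -
      \<comment> \<open>The congruence modulo \<open>a\<close> selects the indicator
        \<open>r\<close>; the one modulo p^2 forces valuation \<open>k\<close>, as k < 2, and
        excludes j = 0.\<close>
      obtain j where j: "j < a * p\<^sup>2" "[j = p ^ e * r] (mod a)" "[j = p ^ k] (mod p\<^sup>2)"
        using binary_chinese_remainder_unique_nat[of a "p^2" "p ^ e * r" "p ^ k"]
          coprime_power_rank[of 2] rank_gt_1 prime_gt_0_nat[OF p(1)] by (auto simp: coprime_commute)
      have dvd: "p ^ l dvd j \<longleftrightarrow> l \<le> k" if "l \<le> 2" for l
      proof -
        have "[j = p ^ k] (mod p ^ l)"
          using j(3) le_imp_power_dvd[OF that] by (rule cong_dvd_modulus_nat)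
        then have "p ^ l dvd j \<longleftrightarrow> p ^ l dvd p ^ k" by (rule cong_dvd_iff)
        then show ?thesis
          using prime_gt_1_nat[OF p(1)] by (simp add: dvd_power_iff)
      qed
      have "multiplicity p j = k"
        using dvd[of k] dvd[of "Suc k"] k by (intro multiplicity_eqI) auto
      moreover have "j > 0"
        using dvd[of 2] k by (cases "j = 0") auto
      moreover have "j < p ^ e" using j(1) e by simp
      ultimately have "seq_scale (int (c + k)) (residue_indicator a r) = (\<lambda>n. s (p ^ e * n + (j - 1)))"
        using kernel_other_residue[of j e r] j(2) by (simp add: cong_sym)
      also have "\<dots> \<in> k_kernel p s"
        unfolding k_kernel_def using \<open>j < p ^ e\<close> by fastforce
      finally show ?thesis by (rule int_seq.span_base)
    qed
    \<comment> \<open>The two coefficients, from valuations 1 and 0, differ by one.\<close>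
    have "residue_indicator a r = seq_scale (int (c + 1)) (residue_indicator a r)
        - seq_scale (int (c + 0)) (residue_indicator a r)"
      by (simp add: seq_scale_def fun_eq_iff algebra_simps)
    then show ?thesis
      using int_seq.span_diff[OF mem[of 1] mem[of 0]] by simp
  qed
  ultimately show ?thesis
    by (auto simp: kernel_basis_def intro: int_seq.span_base)
qed

lemma span_k_kernel: "int_seq.span (k_kernel p s) = int_seq.span kernel_basis"
  unfolding int_seq.span_eq using k_kernel_subset kernel_basis_subset by blast

text \<open>Unbounded values within a single residue class; they separate \<open>s\<close> from the
  indicators.\<close>

lemma fib_multiplicity_at: "s (p ^ k * a - 1) = int (c + k)"
proof -
  have "p ^ k * a > 0" using prime_gt_0_nat[OF p(1)] rank_gt_1 by simp
  moreover have "multiplicity p (fib (p ^ k * a)) = c + k"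
    unfolding c_def
    using p prime_gt_0_nat[OF p(1)] rank_gt_1 dvd_fib_rank_of_apparition[of p]
    by (subst multiplicity_fib_mult) (auto simp flip: a_def)
  ultimately show ?thesis by (simp add: s_def)
qed

lemma fib_multiplicity_not_residue_indicator: "s \<notin> residue_indicator a ` {..<a}"
proof
  assume "s \<in> residue_indicator a ` {..<a}"
  then have "s n \<le> 1" for n by (auto simp: residue_indicator_def)
  from this[of "p ^ 2 * a - 1"] show False by (simp only: fib_multiplicity_at)
qed

lemma finite_kernel_basis: "finite kernel_basis" and card_kernel_basis: "card kernel_basis = a + 1"
  using fib_multiplicity_not_residue_indicator inj_residue_indicator by (simp_all add: kernel_basis_def card_image)

lemma independent_kernel_basis: "int_seq.independent kernel_basis"
proof -
  have "\<forall>v\<in>kernel_basis. u v = 0" if "(\<Sum>v\<in>kernel_basis. seq_scale (u v) v) = 0" for u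
  proof -
    have eq0: "u s * s n + (\<Sum>r<a. u (residue_indicator a r) * residue_indicator a r n) = 0" for n
    proof -
      have "(\<Sum>v\<in>kernel_basis. seq_scale (u v) v) n = 0" using that by simp
      then show ?thesis
        using fib_multiplicity_not_residue_indicator inj_residue_indicator
        by (simp add: kernel_basis_def sum_fun_apply seq_scale_def sum.reindex)
    qed
    \<comment> \<open>At the index m a - q only the indicator of \<open>q\<close> is
      nonzero.\<close>
    have eq: "u s * s (m * a - q) + u (residue_indicator a q) = 0" if "q < a" "m > 0" for q m
    proof -
      have "(\<Sum>r<a. u (residue_indicator a r) * residue_indicator a r (m * a - q)) =
          (\<Sum>r<a. if r = q then u (residue_indicator a r) else 0)"
        using that by (intro sum.cong) (auto simp: residue_indicator_at)
      then show ?thesis using eq0[of "m * a - q"] that(1) by simp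
    qed
    \<comment> \<open>With q = 1 and m = p^k the value of \<open>s\<close> varies with
      \<open>k\<close> while the indicator term is fixed; comparing k = 0 and k = 1 gives
      \<open>u s = 0\<close>. Then m = 1 kills each remaining coefficient.\<close>
    have "u s * int (c + k) + u (residue_indicator a 1) = 0" for k
      using eq[of 1 "p ^ k"] rank_gt_1 prime_gt_0_nat[OF p(1)] by (simp only: fib_multiplicity_at) simp
    from this[of 0] this[of 1] have us: "u s = 0"
      by (simp add: algebra_simps)
    then show ?thesis
      using eq[of _ 1] by (auto simp: kernel_basis_def)
  qed
  then show ?thesis
    unfolding int_seq.dependent_finite[OF finite_kernel_basis] by blast
qed

lemma k_regular_fib_multiplicity: "k_regular p s"
  unfolding k_regular_def finitely_generated_def span_k_kernel using finite_kernel_basis by blast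

lemma k_regular_rank_fib_multiplicity: "k_regular_rank p s = enat (a + 1)"
  unfolding k_regular_rank_def span_k_kernel
  using module_rank_span[OF finite_kernel_basis independent_kernel_basis] by (simp add: card_kernel_basis)

end

theorem theorem1p6:
  fixes p :: nat
  assumes "prime p" and "p \<noteq> 2" and "p \<noteq> 5"
  shows "k_regular p (\<lambda>n. int (multiplicity p (fib (n + 1)))) \<and>
         k_regular_rank p (\<lambda>n. int (multiplicity p (fib (n + 1)))) =
           enat (rank_of_apparition p + 1)"
  using k_regular_fib_multiplicity[OF assms] k_regular_rank_fib_multiplicity[OF assms] by simp

end
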